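(* Let $X$ be an $\aleph_0$-space and $G$ a topological group. If $G$ is an $\aleph$-space, then $C_c(X,G)$ has countable $cs^\ast$-character. Consequently, $C_c(X,G)$ is metrizable if and only if it is Fréchet–Urysohn.
   Context: All topological spaces (and topological groups) are Hausdorff. $C_c(X,G)$ is the set of all continuous functions from $X$ to $G$ with the compact-open topology (subbase: the sets $\{f: f(K)\subseteq U\}$, $K\subseteq X$ compact, $U\subseteq G$ open). A family $\mathcal N$ of subsets of a space $X$ is a $k$-network in $X$ if whenever $K\subset U$ with $K$ compact and $U$ open in $X$, then $K\subset\bigcup\mathcal F\subset U$ for some finite $\mathcal F\subset\mathcal N$. An $\aleph_0$-space is a regular space with a countable $k$-network; an $\aleph$-space is a regular space with a $\sigma$-locally finite $k$-network ($\sigma$-locally finite means a countable union of locally finite families). A family $\mathcal N$ of subsets of $X$ is a $cs^\ast$-network at $x\in X$ if for each sequence $(x_n)_{n\in\mathbb N}$ in $X$ converging to $x$ and each neighborhood $O_x$ of $x$ there is $N\in\mathcal N$ such that $x\in N\subset O_x$ and $\{n\in\mathbb N: x_n\in N\}$ is infinite. $X$ has countable $cs^\ast$-character if it has a countable $cs^\ast$-network at each point $x\in X$. $X$ is Fréchet–Urysohn if whenever $x\in\overline A$, $A\subset X$, there is a sequence in $A$ converging to $x$. *)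

theory Defs
  imports "HOL-Analysis.Analysis"
begin

text \<open>Spaces are abstract topologies. The Hausdorff property, a blanket convention in the source, is
  not built into the definitions below; it is an explicit hypothesis wherever it is needed.\<close>

subsection \<open>Networks\<close>

definition k_network_in :: "'a topology \<Rightarrow> 'a set set \<Rightarrow> bool" where
  "k_network_in X \<N> \<longleftrightarrow>
     (\<forall>N\<in>\<N>. N \<subseteq> topspace X) \<and>
     (\<forall>K U. compactin X K \<and> openin X U \<and> K \<subseteq> U \<longrightarrow>
        (\<exists>\<F>. finite \<F> \<and> \<F> \<subseteq> \<N> \<and> K \<subseteq> \<Union>\<F> \<and> \<Union>\<F> \<subseteq> U))"

definition sigma_locally_finite_in :: "'a topology \<Rightarrow> 'a set set \<Rightarrow> bool" where
  "sigma_locally_finite_in X \<N> \<longleftrightarrow>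
     (\<exists>\<F> :: nat \<Rightarrow> 'a set set. (\<forall>n. locally_finite_in X (\<F> n)) \<and> \<N> = (\<Union>n. \<F> n))"

definition aleph0_space :: "'a topology \<Rightarrow> bool" where
  "aleph0_space X \<longleftrightarrow> regular_space X \<and> (\<exists>\<N>. countable \<N> \<and> k_network_in X \<N>)"

definition aleph_space :: "'a topology \<Rightarrow> bool" where
  "aleph_space X \<longleftrightarrow>
     regular_space X \<and> (\<exists>\<N>. sigma_locally_finite_in X \<N> \<and> k_network_in X \<N>)"

definition cs_star_network_at :: "'a topology \<Rightarrow> 'a \<Rightarrow> 'a set set \<Rightarrow> bool" where
  "cs_star_network_at X x \<N> \<longleftrightarrow>
     (\<forall>N\<in>\<N>. N \<subseteq> topspace X) \<and>
     (\<forall>s :: nat \<Rightarrow> 'a. \<forall>V W. range s \<subseteq> topspace X \<and> limitin X s x sequentially \<and>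
        openin X V \<and> x \<in> V \<and> V \<subseteq> W \<and> W \<subseteq> topspace X \<longrightarrow>
        (\<exists>N\<in>\<N>. x \<in> N \<and> N \<subseteq> W \<and> infinite {n. s n \<in> N}))"

definition countable_cs_star_character :: "'a topology \<Rightarrow> bool" where
  "countable_cs_star_character X \<longleftrightarrow>
     (\<forall>x \<in> topspace X. \<exists>\<N>. countable \<N> \<and> cs_star_network_at X x \<N>)"

definition Frechet_Urysohn_space :: "'a topology \<Rightarrow> bool" where
  "Frechet_Urysohn_space X \<longleftrightarrow>
     (\<forall>A x. A \<subseteq> topspace X \<and> x \<in> X closure_of A \<longrightarrow>
        (\<exists>s :: nat \<Rightarrow> 'a. range s \<subseteq> A \<and> limitin X s x sequentially))"

subsection \<open>The space of continuous functions with the compact-open topology\<close>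

text \<open>A continuous map on the space X is represented by a HOL function that takes the value
  \<^term>\<open>undefined\<close> outside \<^term>\<open>topspace X\<close>, so that distinct elements of the set below
  are distinct as maps on X.\<close>

definition continuous_functions :: "'a topology \<Rightarrow> 'b topology \<Rightarrow> ('a \<Rightarrow> 'b) set" where
  "continuous_functions X Y = {f \<in> extensional (topspace X). continuous_map X Y f}"

definition compact_open_topology :: "'a topology \<Rightarrow> 'b topology \<Rightarrow> ('a \<Rightarrow> 'b) topology" where
  "compact_open_topology X Y = topology_generated_by
     {{f \<in> continuous_functions X Y. f ` K \<subseteq> U} | K U. compactin X K \<and> openin Y U}"

lemma topspace_compact_open_topology [simp]:
  "topspace (compact_open_topology X Y) = continuous_functions X Y"
proof -
  have "continuous_functions X Y \<in>
      {{f \<in> continuous_functions X Y. f ` K \<subseteq> U} | K U. compactin X K \<and> openin Y U}"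
    by (rule CollectI, rule exI[of _ "{}"], rule exI[of _ "topspace Y"]) auto
  then show ?thesis
    unfolding compact_open_topology_def topology_generated_by_topspace by blast
qed

end

theory Submission
  imports Defs "HOL-Algebra.Group"
begin

text \<open>Let \<open>f\<close> be a continuous map. Its image is Lindelof, so each locally finite family has only
  countably many members meeting some neighbourhood of the image. Finite unions \<open>Q\<close> of these and
  members \<open>P\<close> of a countable family derived from the k-network of the domain give countably many sets
  \<open>[P; Q]\<close> of maps sending \<open>P\<close> into \<open>Q\<close>. A sequence converging to \<open>f\<close> in \<open>[K; U]\<close> is eventually in some
  \<open>[P; Q] \<subseteq> [K; U]\<close>: if not, bad points in a decreasing sequence of \<open>P\<close>'s around \<open>K\<close> form a compact set
  together with \<open>K\<close>, on which one \<open>Q\<close> must work.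

  The maps form a topological group. In a non-discrete Frechet-Urysohn group, countably many sets
  accumulating at the unit admit a diagonal sequence converging to it; together with a countable
  cs*-network this makes finitely many members of the network inside a given neighbourhood
  form a neighbourhood, so the unit has a countable base and the Birkhoff-Kakutani theorem applies.\<close>

\<comment> \<open>HOL-Algebra's operator on setoids would make \<open>X closure_of A\<close> ambiguous.\<close>
no_notation eq_closure_of (\<open>closure'_of\<index>\<close>)

subsection \<open>Frechet-Urysohn topological groups\<close>

text \<open>Carrier and topology are explicit parameters because the group of continuous maps on
  \<open>X\<close> is a subset of a function type that varies with the term \<open>X\<close>, so it
  cannot be a type class instance.\<close>

locale topological_group = group G for G (structure) +
  fixes T
  assumes topspace_eq: "topspace T = carrier G"
    and continuous_mult: "continuous_map (prod_topology T T) T (\<lambda>(x, y). x \<otimes> y)"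
    and continuous_inv: "continuous_map T T (\<lambda>x. inv x)"
begin

lemma one_in_topspace: "\<one> \<in> topspace T"
  by (simp add: topspace_eq)

lemma mult_nhds:
  assumes "openin T W" "x \<in> carrier G" "y \<in> carrier G" "x \<otimes> y \<in> W"
  obtains U V where "openin T U" "openin T V" "x \<in> U" "y \<in> V"
    "\<And>u v. u \<in> U \<Longrightarrow> v \<in> V \<Longrightarrow> u \<otimes> v \<in> W"
proof -
  let ?S = "{p \<in> topspace (prod_topology T T). (\<lambda>(x, y). x \<otimes> y) p \<in> W}"
  have "openin (prod_topology T T) ?S"
    using continuous_mult assms(1) by (rule openin_continuous_map_preimage)
  moreover have "(x, y) \<in> ?S"
    using assms topspace_eq by simp
  ultimately have "\<exists>U V. openin T U \<and> openin T V \<and> x \<in> U \<and> y \<in> V \<and> U \<times> V \<subseteq> ?S"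
    by (rule openin_prod_topology_alt[THEN iffD1, rule_format])
  then obtain U V where "openin T U" "openin T V" "x \<in> U" "y \<in> V" "U \<times> V \<subseteq> ?S"
    by blast
  then show thesis
    by (intro that[of U V]) auto
qed

lemma openin_left_translate:
  assumes "openin T W" "a \<in> carrier G"
  shows "openin T {x \<in> carrier G. a \<otimes> x \<in> W}"
proof (subst openin_subopen, intro ballI)
  fix x assume "x \<in> {x \<in> carrier G. a \<otimes> x \<in> W}"
  then obtain U V where "openin T U" "openin T V" "a \<in> U" "x \<in> V"
      "\<And>u v. u \<in> U \<Longrightarrow> v \<in> V \<Longrightarrow> u \<otimes> v \<in> W"
    using mult_nhds[OF assms(1), of a x] assms(2) by blast
  moreover from \<open>openin T V\<close> have "V \<subseteq> carrier G"
    using openin_subset topspace_eq by blast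
  ultimately show "\<exists>V. openin T V \<and> x \<in> V \<and> V \<subseteq> {x \<in> carrier G. a \<otimes> x \<in> W}"
    by (intro exI[of _ V]) auto
qed

lemma limitin_mult:
  assumes "limitin T f x F" "limitin T g y F"
  shows "limitin T (\<lambda>i. f i \<otimes> g i) (x \<otimes> y) F"
proof -
  have "limitin T ((\<lambda>(x, y). x \<otimes> y) \<circ> (\<lambda>i. (f i, g i))) ((\<lambda>(x, y). x \<otimes> y) (x, y)) F"
    using continuous_mult by (rule continuous_map_limit) (simp add: limitin_pairwise assms o_def)
  then show ?thesis
    by (simp add: o_def)
qed

lemma limitin_inv:
  assumes "limitin T f x F"
  shows "limitin T (\<lambda>i. inv (f i)) (inv x) F"
  using continuous_map_limit[OF continuous_inv assms] by (simp add: o_def)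

text \<open>Translating the \<open>i\<close>-th set to a point \<open>z i \<noteq> \<one>\<close> of a sequence converging to \<open>\<one>\<close> prevents a
  sequence that converges to \<open>\<one>\<close> from staying inside finitely many of the translates.\<close>

lemma Frechet_Urysohn_diagonal:
  assumes "Hausdorff_space T" and FU: "Frechet_Urysohn_space T" and nd: "\<not> openin T {\<one>}"
    and A: "\<And>i :: nat. \<one> \<in> T closure_of A i"
  obtains s and r :: "nat \<Rightarrow> nat" where "limitin T s \<one> sequentially" "\<And>j. s j \<in> A (r j) \<inter> carrier G"
    "filterlim r at_top sequentially"
proof -
  \<comment> \<open>As the group is not discrete, the unit is a limit of other points
    \<open>z i\<close>; these serve as translations.\<close>
  have "T interior_of {\<one>} = {}"
    using nd subset_singletonD[OF interior_of_subset[of T "{\<one>}"]] openin_interior_of[of T "{\<one>}"]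
    by metis
  then have "\<one> \<in> T closure_of (topspace T - {\<one>})"
    using one_in_topspace by (simp add: closure_of_complement)
  then obtain z where z: "range z \<subseteq> topspace T - {\<one>}" "limitin T z \<one> sequentially"
    using FU unfolding Frechet_Urysohn_space_def by (metis Diff_subset)
  then have zG: "z i \<in> carrier G" "z i \<noteq> \<one>" for i :: nat
    using topspace_eq by auto
  have "\<exists>V W. openin T V \<and> openin T W \<and> z i \<in> V \<and> \<one> \<in> W \<and> V \<inter> W = {}" for i
    using assms(1) zG[of i] one_closed unfolding Hausdorff_space_def topspace_eq disjnt_def by metis
  then obtain V W where V: "\<And>i. openin T (V i)" "\<And>i. z i \<in> V i"
    and W: "\<And>i. openin T (W i)" "\<And>i. \<one> \<in> W i" and VW: "\<And>i. V i \<inter> W i = {}"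
    by metis
  \<comment> \<open>Cutting the translate of \<open>A i\<close> down to \<open>V i\<close> keeps it
    out of the neighbourhood \<open>W i\<close> of the unit. \<open>B\<close> still accumulates at
    the unit, because \<open>z i\<close> converges to it and each \<open>A i\<close> accumulates
    there.\<close>
  define B where "B = {y. \<exists>i a. y = z i \<otimes> a \<and> a \<in> A i \<inter> carrier G \<and> y \<in> V i}"
  have "B \<subseteq> topspace T"
    using zG topspace_eq by (auto simp: B_def)
  moreover have "\<one> \<in> T closure_of B"
    unfolding in_closure_of
  proof (intro conjI allI impI)
    fix O' assume O': "\<one> \<in> O' \<and> openin T O'"
    then obtain i where i: "z i \<in> O'"
      using z(2) unfolding limitin_sequentially by blast
    let ?O = "{x \<in> carrier G. z i \<otimes> x \<in> O' \<inter> V i}"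
    have "openin T ?O" "\<one> \<in> ?O"
      using O' V i zG openin_left_translate[of "O' \<inter> V i" "z i"] by auto
    then have "\<exists>a. a \<in> A i \<and> a \<in> ?O"
      by (intro A[of i, unfolded in_closure_of, THEN conjunct2, rule_format] conjI)
    then obtain a where "a \<in> A i" "a \<in> carrier G" "z i \<otimes> a \<in> O'" "z i \<otimes> a \<in> V i"
      by auto
    then show "\<exists>y. y \<in> B \<and> y \<in> O'"
      unfolding B_def by (intro exI[of _ "z i \<otimes> a"]) force
  qed (simp add: topspace_eq)
  ultimately obtain b where b: "range b \<subseteq> B" "limitin T b \<one> sequentially"
    using FU unfolding Frechet_Urysohn_space_def by blast
  have "\<exists>i a. b j = z i \<otimes> a \<and> a \<in> A i \<inter> carrier G \<and> b j \<in> V i" for j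
  proof -
    have "b j \<in> B"
      using b(1) by blast
    then show ?thesis
      by (simp add: B_def)
  qed
  then obtain r a where ra: "\<And>j. b j = z (r j) \<otimes> a j" "\<And>j. a j \<in> A (r j) \<inter> carrier G"
      "\<And>j. b j \<in> V (r j)"
    by metis
  \<comment> \<open>For every \<open>i < n\<close> the sequence \<open>b\<close> finally stays in
    \<open>W i\<close>, which the points taken from the \<open>i\<close>-th translate avoid; hence
    the index is eventually at least \<open>n\<close>.\<close>
  have r: "filterlim r at_top sequentially"
    unfolding filterlim_at_top
  proof
    fix n
    have "\<forall>\<^sub>F j in sequentially. \<forall>i\<in>{..<n}. b j \<in> W i"
      using b(2) W by (intro eventually_ball_finite) (auto dest: limitinD)
    then show "\<forall>\<^sub>F j in sequentially. n \<le> r j"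
    proof (rule eventually_mono)
      fix j assume *: "\<forall>i\<in>{..<n}. b j \<in> W i"
      have "b j \<notin> W (r j)"
        using ra(3) VW by blast
      with * show "n \<le> r j"
        by (metis lessThan_iff not_le)
    qed
  qed
  have "limitin T (\<lambda>j. z (r j)) \<one> sequentially"
    using z(2) r unfolding limitin_def filterlim_iff by blast
  then have "limitin T (\<lambda>j. inv (z (r j)) \<otimes> b j) (inv \<one> \<otimes> \<one>) sequentially"
    using b(2) by (intro limitin_mult limitin_inv)
  moreover have "inv (z (r j)) \<otimes> b j = a j" for j
    using ra(1)[of j] ra(2)[of j] zG[of "r j"] by (simp add: m_assoc[symmetric])
  ultimately have "limitin T a \<one> sequentially"
    by simp
  then show thesis
    using that ra(2) r by blast
qed

text \<open>If no finite union of network members inside \<open>U\<close> is a neighbourhood of the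
  unit, the complements of these unions accumulate at the unit. A diagonal sequence through them
  converges to the unit but finally leaves each member, against the cs*-property.\<close>

lemma countable_base_at_one:
  assumes "Hausdorff_space T" and FU: "Frechet_Urysohn_space T"
    and "countable \<N>" and cs: "cs_star_network_at T \<one> \<N>"
  obtains \<B> where "countable \<B>" "\<And>V. V \<in> \<B> \<Longrightarrow> openin T V"
    "\<And>U. openin T U \<Longrightarrow> \<one> \<in> U \<Longrightarrow> \<exists>V\<in>\<B>. \<one> \<in> V \<and> V \<subseteq> U"
proof (cases "openin T {\<one>}")
  case True
  then show thesis
    by (intro that[of "{{\<one>}}"]) auto
next
  case nd: False
  define \<B> where "\<B> = (\<lambda>\<F>. T interior_of \<Union>\<F>) ` {\<F>. finite \<F> \<and> \<F> \<subseteq> \<N>}"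
  have "\<exists>V\<in>\<B>. \<one> \<in> V \<and> V \<subseteq> U" if U: "openin T U" "\<one> \<in> U" for U
  proof (rule ccontr)
    assume contr: "\<not> (\<exists>V\<in>\<B>. \<one> \<in> V \<and> V \<subseteq> U)"
    define \<M> where "\<M> = {N \<in> \<N>. N \<subseteq> U}"
    have cs_U: "\<exists>N\<in>\<M>. infinite {n. s n \<in> N}"
      if "range s \<subseteq> carrier G" "limitin T s \<one> sequentially" for s
      using cs that U openin_subset[OF U(1)] unfolding cs_star_network_at_def \<M>_def topspace_eq
      by blast
    \<comment> \<open>The constant sequence at the unit already forces a member inside
      \<open>U\<close>, so \<open>\<M>\<close> can be enumerated by \<open>nat\<close>.\<close>
    have "\<M> \<noteq> {}"
      using cs_U[of "\<lambda>_. \<one>"] topspace_eq by auto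
    moreover have "countable \<M>"
      using \<open>countable \<N>\<close> unfolding \<M>_def by simp
    ultimately obtain M :: "nat \<Rightarrow> 'a set" where M: "range M = \<M>"
      by (metis range_from_nat_into)
    have "\<one> \<in> T closure_of (topspace T - (\<Union>k\<le>i. M k))" for i
    proof -
      have "M ` {..i} \<subseteq> {N \<in> \<N>. N \<subseteq> U}"
        using M \<M>_def by blast
      then have "finite (M ` {..i}) \<and> M ` {..i} \<subseteq> \<N>" and "\<Union>(M ` {..i}) \<subseteq> U"
        by auto
      then have "T interior_of \<Union>(M ` {..i}) \<in> \<B>"
        unfolding \<B>_def by (intro imageI CollectI)
      then have "\<one> \<notin> T interior_of \<Union>(M ` {..i})"
        using contr \<open>\<Union>(M ` {..i}) \<subseteq> U\<close> by (meson interior_of_subset order_trans)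
      then show ?thesis
        using one_in_topspace by (simp add: closure_of_complement)
    qed
    then obtain s and r :: "nat \<Rightarrow> nat" where s: "limitin T s \<one> sequentially"
      "\<And>j. s j \<in> (topspace T - (\<Union>k\<le>r j. M k)) \<inter> carrier G" "filterlim r at_top sequentially"
      using Frechet_Urysohn_diagonal[OF assms(1) FU nd, of "\<lambda>i. topspace T - (\<Union>k\<le>i. M k)"]
      by blast
    then obtain m where m: "infinite {j. s j \<in> M m}"
      using cs_U[of s] M by blast
    have "\<forall>\<^sub>F j in sequentially. m \<le> r j"
      using s(3) unfolding filterlim_at_top by blast
    then have "\<forall>\<^sub>F j in sequentially. s j \<notin> M m"
      by (rule eventually_mono) (use s(2) in blast)
    then show False
      using m by (simp add: cofinite_eq_sequentially[symmetric] eventually_cofinite)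
  qed
  moreover have "countable \<B>"
    unfolding \<B>_def using \<open>countable \<N>\<close> by (intro countable_image countable_Collect_finite_subset)
  ultimately show thesis
    by (intro that[of \<B>]) (auto simp: \<B>_def)
qed

end

subsection \<open>The Birkhoff-Kakutani theorem\<close>

text \<open>The entry \<open>n\<close> is the first one after which the remaining weight is below
  \<open>b\<close>; what precedes it then weighs less than \<open>a\<close>. It is applied with
  \<open>a = b\<close> to halve a factorization around one middle factor.\<close>

lemma sum_list_split:
  fixes w :: "'b \<Rightarrow> real"
  assumes "(\<Sum>n\<leftarrow>ns. w n) < a + b" "0 < a" "0 < b" "ns \<noteq> []"
  obtains ks n ls where "ns = ks @ n # ls" "(\<Sum>n\<leftarrow>ks. w n) < a" "(\<Sum>n\<leftarrow>ls. w n) < b"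
  using assms
proof (induction ns arbitrary: a thesis)
  case (Cons n ns)
  show ?case
  proof (cases "(\<Sum>n\<leftarrow>ns. w n) < b")
    case True
    then show ?thesis
      using Cons.prems(1)[of "[]" n ns] Cons.prems(3) by simp
  next
    case False
    then have "0 < a - w n" "ns \<noteq> []" "(\<Sum>n\<leftarrow>ns. w n) < a - w n + b"
      using Cons.prems by auto
    then obtain ks m ls where "ns = ks @ m # ls" "(\<Sum>n\<leftarrow>ks. w n) < a - w n" "(\<Sum>n\<leftarrow>ls. w n) < b"
      using Cons.IH \<open>0 < b\<close> by metis
    then show ?thesis
      using Cons.prems(1)[of "n # ks" m ls] by simp
  qed
qed simp

lemma Cinf_add_le:
  fixes S S' S'' :: "real set"
  assumes "S \<noteq> {}" "S' \<noteq> {}" "bdd_below S''" "\<And>a b. a \<in> S \<Longrightarrow> b \<in> S' \<Longrightarrow> a + b \<in> S''"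
  shows "Inf S'' \<le> Inf S + Inf S'"
proof -
  have "Inf S'' - b \<le> Inf S" if "b \<in> S'" for b
    using assms that by (intro cInf_greatest) (auto simp: diff_le_eq intro: cInf_lower)
  then have "Inf S'' - Inf S \<le> Inf S'"
    using assms by (intro cInf_greatest) (auto simp: algebra_simps)
  then show ?thesis
    by simp
qed

section \<open>Product sets along lists of indices\<close>

context group
begin

text \<open>The list of indices stays visible so that a factorization can be assigned the sum of the
  weights \<open>(1/2) ^ n\<close> of its factors.\<close>

primrec set_chain :: "(nat \<Rightarrow> 'a set) \<Rightarrow> nat list \<Rightarrow> 'a set" where
  "set_chain U [] = {\<one>}"
| "set_chain U (n # ns) = {u \<otimes> x |u x. u \<in> U n \<and> x \<in> set_chain U ns}"

lemma set_chain_closed: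
  assumes "\<And>n. U n \<subseteq> carrier G"
  shows "x \<in> set_chain U ns \<Longrightarrow> x \<in> carrier G"
  using assms by (induction ns arbitrary: x) auto

lemma set_chain_append:
  assumes U: "\<And>n. U n \<subseteq> carrier G"
  shows "x \<in> set_chain U (ns @ ms) \<longleftrightarrow> (\<exists>a b. a \<in> set_chain U ns \<and> b \<in> set_chain U ms \<and> x = a \<otimes> b)"
proof (induction ns arbitrary: x)
  case Nil
  then show ?case
    using set_chain_closed[of U, OF U] by auto
next
  case (Cons n ns)
  have assoc: "u \<otimes> (a \<otimes> b) = u \<otimes> a \<otimes> b" if "u \<in> U n" "a \<in> set_chain U ns" "b \<in> set_chain U ms" for u a b
    using that U set_chain_closed[of U, OF U] by (metis m_assoc subsetD)
  show ?case
    unfolding append_Cons set_chain.simps mem_Collect_eq Cons.IH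
  proof (intro iffI; elim exE conjE)
    fix u y a b assume "u \<in> U n" "a \<in> set_chain U ns" "b \<in> set_chain U ms" "x = u \<otimes> y" "y = a \<otimes> b"
    then show "\<exists>a b. (\<exists>u x. a = u \<otimes> x \<and> u \<in> U n \<and> x \<in> set_chain U ns) \<and> b \<in> set_chain U ms \<and> x = a \<otimes> b"
      using assoc by (intro exI[of _ "u \<otimes> a"] exI[of _ b]) auto
  next
    fix c b u a assume "u \<in> U n" "a \<in> set_chain U ns" "b \<in> set_chain U ms" "x = c \<otimes> b" "c = u \<otimes> a"
    then show "\<exists>u y. x = u \<otimes> y \<and> u \<in> U n \<and> (\<exists>a b. a \<in> set_chain U ns \<and> b \<in> set_chain U ms \<and> y = a \<otimes> b)"
      using assoc by (intro exI[of _ u] exI[of _ "a \<otimes> b"]) auto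
  qed
qed

text \<open>Inversion reverses the order of the factors; the total weight of the list is unaffected,
  which later makes the norm symmetric.\<close>

lemma inv_set_chain:
  assumes U: "\<And>n. U n \<subseteq> carrier G" and inv_U: "\<And>n u. u \<in> U n \<Longrightarrow> inv u \<in> U n"
  shows "x \<in> set_chain U ns \<Longrightarrow> inv x \<in> set_chain U (rev ns)"
proof (induction ns arbitrary: x)
  case (Cons n ns)
  then obtain u y where "x = u \<otimes> y" "u \<in> U n" "y \<in> set_chain U ns"
    by auto
  moreover from this have "u \<in> carrier G" "y \<in> carrier G"
    using U set_chain_closed[of U, OF U] by blast+
  moreover have "inv u \<in> set_chain U [n]"
    using inv_U[OF \<open>u \<in> U n\<close>] U by (auto intro!: exI[of _ "inv u"] simp: subset_iff)
  ultimately show ?case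
    using Cons.IH by (auto simp: set_chain_append[of U, OF U] inv_mult_group)
qed simp

text \<open>The core of the metrization. A list lighter than \<open>(1/2) ^ k\<close> splits into
  two shorter lists lighter than \<open>(1/2) ^ Suc k\<close> and one middle entry
  \<open>n > k\<close>. All three parts give subsets of \<open>U (Suc k)\<close>, and triple
  products from there lie in \<open>U k\<close>.\<close>

lemma set_chain_subset:
  assumes U: "\<And>n. U n \<subseteq> carrier G" and one_U: "\<And>n. \<one> \<in> U n"
    and U_Suc: "\<And>n u v w. u \<in> U (Suc n) \<Longrightarrow> v \<in> U (Suc n) \<Longrightarrow> w \<in> U (Suc n) \<Longrightarrow> u \<otimes> v \<otimes> w \<in> U n"
  shows "(\<Sum>n\<leftarrow>ns. (1/2 :: real) ^ n) < (1/2) ^ k \<Longrightarrow> set_chain U ns \<subseteq> U k"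
proof (induction "length ns" arbitrary: ns k rule: less_induct)
  case less
  \<comment> \<open>Taking two of the three factors to be the unit shows that \<open>U\<close> is
    decreasing.\<close>
  have "u \<otimes> \<one> \<otimes> \<one> = u" if "u \<in> U n" for u n
    using that U[of n] by auto
  then have "U (Suc n) \<subseteq> U n" for n
    using U_Suc[of _ n \<one> \<one>] one_U[of "Suc n"] by (metis subsetI)
  then have antimono: "U n \<subseteq> U m" if "m \<le> n" for m n
    using that lift_Suc_antimono_le[of U m n] by blast
  show ?case
  proof (cases "ns = []")
    case True
    then show ?thesis
      using one_U by simp
  next
    case False
    have "(\<Sum>n\<leftarrow>ns. (1/2 :: real) ^ n) < (1/2) ^ Suc k + (1/2) ^ Suc k"
      using less.prems by simp
    then obtain ks n ls where ns: "ns = ks @ n # ls" "(\<Sum>n\<leftarrow>ks. (1/2 :: real) ^ n) < (1/2) ^ Suc k"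
        "(\<Sum>n\<leftarrow>ls. (1/2 :: real) ^ n) < (1/2) ^ Suc k"
      using False by (elim sum_list_split) auto
    have "(\<Sum>n\<leftarrow>ns. (1/2 :: real) ^ n) = (\<Sum>n\<leftarrow>ks. (1/2) ^ n) + (1/2) ^ n + (\<Sum>n\<leftarrow>ls. (1/2) ^ n)"
      by (simp add: ns(1))
    moreover have "0 \<le> (\<Sum>n\<leftarrow>ks. (1/2 :: real) ^ n)" "0 \<le> (\<Sum>n\<leftarrow>ls. (1/2 :: real) ^ n)"
      by (auto intro!: sum_list_nonneg)
    ultimately have "(1/2 :: real) ^ n < (1/2) ^ k"
      using less.prems by linarith
    then have "k < n"
      using power_decreasing[of n k "1/2 :: real"] by (simp add: not_less flip: not_le)
    then have n: "U n \<subseteq> U (Suc k)"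
      by (intro antimono) simp
    have IH: "set_chain U ks \<subseteq> U (Suc k)" "set_chain U ls \<subseteq> U (Suc k)"
      using ns by (intro less.hyps; simp)+
    show ?thesis
    proof
      fix x assume "x \<in> set_chain U ns"
      then obtain a u b where "a \<in> set_chain U ks" "u \<in> U n" "b \<in> set_chain U ls" "x = a \<otimes> (u \<otimes> b)"
        using ns(1) by (auto simp: set_chain_append[of U, OF U])
      moreover from this have "x = a \<otimes> u \<otimes> b"
        using U set_chain_closed[of U, OF U] by (metis m_assoc subsetD)
      ultimately show "x \<in> U k"
        using U_Suc[of a k u b] IH n by auto
    qed
  qed
qed

end

section \<open>From a countable base at the unit to a left-invariant metric\<close>

context topological_group
begin

text \<open>Triple products match the splitting of a list into two outer parts and a middle entry.
  The choice of \<open>U 0\<close> gives every group element at least one factorization, so that its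
  norm is an infimum over a nonempty set.\<close>

lemma nested_symmetric_nhds:
  assumes "countable \<B>" "\<And>V. V \<in> \<B> \<Longrightarrow> openin T V"
    "\<And>U. openin T U \<Longrightarrow> \<one> \<in> U \<Longrightarrow> \<exists>V\<in>\<B>. \<one> \<in> V \<and> V \<subseteq> U"
  obtains U :: "nat \<Rightarrow> 'a set" where
    "\<And>n. openin T (U n)" "\<And>n. \<one> \<in> U n" "U 0 = carrier G" "\<And>n u. u \<in> U n \<Longrightarrow> inv u \<in> U n"
    "\<And>n u v w. u \<in> U (Suc n) \<Longrightarrow> v \<in> U (Suc n) \<Longrightarrow> w \<in> U (Suc n) \<Longrightarrow> u \<otimes> v \<otimes> w \<in> U n"
    "\<And>V. openin T V \<Longrightarrow> \<one> \<in> V \<Longrightarrow> \<exists>n. U n \<subseteq> V"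
proof -
  have "{V \<in> \<B>. \<one> \<in> V} \<noteq> {}"
    using assms(3)[of "topspace T"] one_in_topspace by auto
  moreover have "countable {V \<in> \<B>. \<one> \<in> V}"
    using assms(1) by simp
  ultimately obtain B :: "nat \<Rightarrow> 'a set" where B: "range B = {V \<in> \<B>. \<one> \<in> V}"
    by (metis range_from_nat_into)
  then have openB: "openin T (B n)" "\<one> \<in> B n" for n
    using assms(2) by blast+
  \<comment> \<open>\<open>P\<close> collects the conditions on a single stage and \<open>Q\<close>
    those linking consecutive stages, as dependent choice asks.\<close>
  define P where "P n U \<longleftrightarrow> openin T U \<and> \<one> \<in> U \<and> (\<forall>u\<in>U. inv u \<in> U) \<and> (n = (0::nat) \<longrightarrow> U = carrier G)" for n U
  define Q where "Q n U W \<longleftrightarrow> (\<forall>u\<in>W. \<forall>v\<in>W. \<forall>w\<in>W. u \<otimes> v \<otimes> w \<in> U) \<and> W \<subseteq> B n" for n U W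
  have "\<exists>f. \<forall>n. P n (f n) \<and> Q n (f n) (f (Suc n))"
  proof (rule dependent_nat_choice)
    show "\<exists>U. P 0 U"
      using openin_topspace[of T] topspace_eq by (auto simp: P_def)
    fix U n assume "P n U"
    then have U: "openin T U" "\<one> \<in> U"
      by (auto simp: P_def)
    \<comment> \<open>Continuity of multiplication at the unit is used twice: \<open>W1\<close>
      times \<open>W2\<close> lies in \<open>V1\<close>, and \<open>V1\<close> times
      \<open>V2\<close> lies in \<open>U\<close>, which handles three factors.\<close>
    obtain V1 V2 where V: "openin T V1" "openin T V2" "\<one> \<in> V1" "\<one> \<in> V2"
        "\<And>u v. u \<in> V1 \<Longrightarrow> v \<in> V2 \<Longrightarrow> u \<otimes> v \<in> U"
      using mult_nhds[of U \<one> \<one>] U by auto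
    obtain W1 W2 where W: "openin T W1" "openin T W2" "\<one> \<in> W1" "\<one> \<in> W2"
        "\<And>u v. u \<in> W1 \<Longrightarrow> v \<in> W2 \<Longrightarrow> u \<otimes> v \<in> V1"
      using mult_nhds[of V1 \<one> \<one>] V by auto
    define X where "X = V2 \<inter> W1 \<inter> W2 \<inter> B n"
    have X: "openin T X" "\<one> \<in> X"
      using V(2,4) W(1-4) openB[of n] by (auto simp: X_def)
    define Y where "Y = X \<inter> {x \<in> topspace T. inv x \<in> X}"
    have "openin T Y"
      unfolding Y_def using X(1) openin_continuous_map_preimage[OF continuous_inv X(1)] by blast
    then have "P (Suc n) Y"
      using X(2) openin_subset[OF X(1)] topspace_eq by (auto simp: P_def Y_def)
    moreover have "Q n U Y"
      unfolding Q_def Y_def X_def using V(5) W(5) by blast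
    ultimately show "\<exists>Y. P (Suc n) Y \<and> Q n U Y"
      by blast
  qed
  then obtain U where U: "\<And>n. P n (U n)" "\<And>n. Q n (U n) (U (Suc n))"
    by blast
  show thesis
  proof (rule that[of U])
    show "\<exists>n. U n \<subseteq> V" if V: "openin T V" "\<one> \<in> V" for V
    proof -
      obtain n where "B n \<subseteq> V"
        using assms(3)[OF V] B by (metis (no_types, lifting) mem_Collect_eq rangeE)
      then show ?thesis
        using U(2)[of n] unfolding Q_def by blast
    qed
    show "u \<otimes> v \<otimes> w \<in> U n" if "u \<in> U (Suc n)" "v \<in> U (Suc n)" "w \<in> U (Suc n)" for n u v w
      using U(2)[of n] that unfolding Q_def by blast
    show "inv u \<in> U n" if "u \<in> U n" for n u
      using U(1)[of n] that by (simp_all add: P_def)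
    show "openin T (U n)" "\<one> \<in> U n" for n
      using U(1)[of n] by (simp_all add: P_def)
    show "U 0 = carrier G"
      using U(1)[of 0] by (simp add: P_def)
  qed
qed

text \<open>The norm of \<open>x\<close> is the infimum of the sums \<open>\<Sum> (1/2)^n\<^sub>i\<close> over all factorizations of \<open>x\<close> into
  factors from \<open>U n\<^sub>i\<close>.\<close>

theorem Birkhoff_Kakutani:
  assumes "Hausdorff_space T" and "countable \<B>" "\<And>V. V \<in> \<B> \<Longrightarrow> openin T V"
    "\<And>U. openin T U \<Longrightarrow> \<one> \<in> U \<Longrightarrow> \<exists>V\<in>\<B>. \<one> \<in> V \<and> V \<subseteq> U"
  shows "metrizable_space T"
proof -
  obtain U :: "nat \<Rightarrow> 'a set" where
    U: "\<And>n. openin T (U n)" "\<And>n. \<one> \<in> U n" "U 0 = carrier G" "\<And>n u. u \<in> U n \<Longrightarrow> inv u \<in> U n"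
    "\<And>n u v w. u \<in> U (Suc n) \<Longrightarrow> v \<in> U (Suc n) \<Longrightarrow> w \<in> U (Suc n) \<Longrightarrow> u \<otimes> v \<otimes> w \<in> U n"
    and base: "\<And>V. openin T V \<Longrightarrow> \<one> \<in> V \<Longrightarrow> \<exists>n. U n \<subseteq> V"
    using nested_symmetric_nhds[OF assms(2-4)] by metis
  have UG: "U n \<subseteq> carrier G" for n
    using openin_subset[OF U(1)] topspace_eq by simp
  define L where "L x = {(\<Sum>n\<leftarrow>ns. (1/2 :: real) ^ n) |ns. x \<in> set_chain U ns}" for x
  define N where "N x = Inf (L x)" for x
  have L_nonneg: "0 \<le> a" if "a \<in> L x" for a x
    using that by (auto simp: L_def intro!: sum_list_nonneg)
  have bdd: "bdd_below (L x)" for x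
    using L_nonneg by (rule bdd_belowI)
  have L_U: "(1/2) ^ n \<in> L x" if "x \<in> U n" for n x
    unfolding L_def using that UG[of n] by (force intro!: exI[of _ "[n]"])
  then have L_ne: "L x \<noteq> {}" if "x \<in> carrier G" for x
    using that U(3) by blast
  have N_nonneg: "0 \<le> N x" if "x \<in> carrier G" for x
    unfolding N_def using L_ne[OF that] L_nonneg by (intro cInf_greatest) auto
  \<comment> \<open>Together with \<open>N_less\<close> this places \<open>U n\<close> between the
    sets given by \<open>N x < (1/2) ^ n\<close> and \<open>N x \<le> (1/2) ^ n\<close>, which is
    why the metric below induces \<open>T\<close>.\<close>
  have N_U: "N x \<le> (1/2) ^ n" if "x \<in> U n" for n x
    unfolding N_def using L_U[OF that] bdd by (rule cInf_lower)
  have N_less: "x \<in> U n" if x: "N x < (1/2) ^ n" "x \<in> carrier G" for n x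
  proof -
    obtain a where "a \<in> L x" "a < (1/2) ^ n"
      using cInf_lessD[OF L_ne[OF x(2)]] x(1) unfolding N_def by blast
    then show ?thesis
      using set_chain_subset[of U _ n, OF UG U(2,5)] unfolding L_def by blast
  qed
  have "0 \<in> L \<one>"
    by (auto simp: L_def intro!: exI[of _ "[]"])
  then have N_one: "N \<one> = 0"
    using N_nonneg[of \<one>] cInf_lower[OF _ bdd, of 0 \<one>] by (simp add: N_def)
  have "L (inv x) \<subseteq> L x" if "x \<in> carrier G" for x
  proof
    fix a assume "a \<in> L (inv x)"
    then obtain ns where ns: "a = (\<Sum>n\<leftarrow>ns. (1/2) ^ n)" "inv x \<in> set_chain U ns"
      by (auto simp: L_def)
    then have "x \<in> set_chain U (rev ns)"
      using inv_set_chain[of U "inv x" ns, OF UG U(4)] that by simp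
    moreover have "a = (\<Sum>n\<leftarrow>rev ns. (1/2) ^ n)"
      using ns by (simp add: rev_map[symmetric])
    ultimately show "a \<in> L x"
      unfolding L_def by blast
  qed
  then have N_inv: "N (inv x) = N x" if "x \<in> carrier G" for x
    unfolding N_def using that by (metis inv_closed inv_inv subset_antisym)
  have N_mult: "N (x \<otimes> y) \<le> N x + N y" if "x \<in> carrier G" "y \<in> carrier G" for x y
    unfolding N_def
  proof (rule Cinf_add_le)
    fix a b assume "a \<in> L x" "b \<in> L y"
    then obtain ns ms where "a = (\<Sum>n\<leftarrow>ns. (1/2) ^ n)" "x \<in> set_chain U ns"
        "b = (\<Sum>n\<leftarrow>ms. (1/2) ^ n)" "y \<in> set_chain U ms"
      by (auto simp: L_def)
    moreover from this have "x \<otimes> y \<in> set_chain U (ns @ ms)"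
      by (auto simp: set_chain_append[of U, OF UG])
    ultimately show "a + b \<in> L (x \<otimes> y)"
      unfolding L_def by (auto intro!: exI[of _ "ns @ ms"])
  qed (use that L_ne bdd in auto)
  have N_zero: "x = \<one>" if x: "N x = 0" "x \<in> carrier G" for x
  proof (rule ccontr)
    assume "x \<noteq> \<one>"
    then obtain V W where "openin T V" "\<one> \<in> V" "x \<in> W" "disjnt V W"
      using assms(1) x(2) unfolding Hausdorff_space_def topspace_eq by (metis one_closed)
    then obtain n where "x \<notin> U n"
      using base by (meson disjnt_iff subsetD)
    then show False
      using N_less[of x n] x by simp
  qed
  \<comment> \<open>The left-invariant metric of the norm. The value 0 outside the carrier keeps
    \<open>d\<close> nonnegative and symmetric on the whole type, as \<open>Metric_space\<close>
    demands.\<close>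
  define d where "d x y = (if x \<in> carrier G \<and> y \<in> carrier G then N (inv x \<otimes> y) else 0)" for x y
  have shift: "inv x \<otimes> z = (inv x \<otimes> y) \<otimes> (inv y \<otimes> z)"
    if "x \<in> carrier G" "y \<in> carrier G" "z \<in> carrier G" for x y z
  proof -
    have "(inv x \<otimes> y) \<otimes> (inv y \<otimes> z) = inv x \<otimes> (y \<otimes> inv y \<otimes> z)"
      using that by (simp only: m_assoc inv_closed m_closed)
    then show ?thesis
      using that by simp
  qed
  interpret Metric_space "carrier G" d
  proof
    fix x y show "0 \<le> d x y"
      by (simp add: d_def N_nonneg)
    have "inv (inv x \<otimes> y) = inv y \<otimes> x" if "x \<in> carrier G" "y \<in> carrier G"
      using that by (simp add: inv_mult_group)
    then show "d x y = d y x"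
      using N_inv[of "inv x \<otimes> y"] by (auto simp: d_def)
  next
    fix x y assume xy: "x \<in> carrier G" "y \<in> carrier G"
    have "inv x \<otimes> y = \<one> \<longleftrightarrow> x = y"
      using xy by (metis inv_equality inv_inv inv_closed l_inv)
    moreover have "N (inv x \<otimes> y) = 0 \<longleftrightarrow> inv x \<otimes> y = \<one>"
      using xy N_zero[of "inv x \<otimes> y"] N_one by fastforce
    ultimately show "d x y = 0 \<longleftrightarrow> x = y"
      using xy by (simp add: d_def)
  next
    fix x y z assume "x \<in> carrier G" "y \<in> carrier G" "z \<in> carrier G"
    then show "d x z \<le> d x y + d y z"
      using N_mult[of "inv x \<otimes> y" "inv y \<otimes> z"] shift[of x y z] by (simp add: d_def)
  qed
  have "T = mtopology"
  proof (rule topology_eq[THEN iffD2], intro allI iffI)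
    fix S assume S: "openin T S"
    show "openin mtopology S"
      unfolding openin_mtopology
    proof (intro conjI allI impI)
      show SG: "S \<subseteq> carrier G"
        using openin_subset[OF S] topspace_eq by simp
      fix x assume x: "x \<in> S"
      then have xG: "x \<in> carrier G"
        using SG by blast
      \<comment> \<open>Pulling \<open>S\<close> back along left translation by \<open>x\<close>
        moves the question to the unit, where the sets \<open>U n\<close> form a base.\<close>
      obtain n where n: "U n \<subseteq> {z \<in> carrier G. x \<otimes> z \<in> S}"
        using base[OF openin_left_translate[OF S xG]] x xG by auto
      have "mball x ((1/2) ^ n) \<subseteq> S"
      proof
        fix y assume y: "y \<in> mball x ((1/2) ^ n)"
        then have "inv x \<otimes> y \<in> U n"
          using N_less[of "inv x \<otimes> y" n] by (auto simp: d_def)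
        then have "x \<otimes> (inv x \<otimes> y) \<in> S"
          using n by blast
        then show "y \<in> S"
          using y xG by (simp add: m_assoc[symmetric])
      qed
      then show "\<exists>r>0. mball x r \<subseteq> S"
        by (intro exI[of _ "(1/2) ^ n"]) auto
    qed
  next
    fix S assume S: "openin mtopology S"
    show "openin T S"
    proof (subst openin_subopen, intro ballI)
      fix x assume x: "x \<in> S"
      then obtain r where r: "0 < r" "mball x r \<subseteq> S" and xG: "x \<in> carrier G"
        using S unfolding openin_mtopology by blast
      obtain n where n: "(1/2) ^ n < r"
        using real_arch_pow_inv[of r "1/2"] r by auto
      let ?V = "{y \<in> carrier G. inv x \<otimes> y \<in> U n}"
      have "openin T ?V"
        using U(1) xG by (intro openin_left_translate) auto
      moreover have "?V \<subseteq> mball x r"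
        using N_U n xG by (fastforce simp: d_def)
      moreover have "x \<in> ?V"
        using U(2) xG by simp
      ultimately show "\<exists>V. openin T V \<and> x \<in> V \<and> V \<subseteq> S"
        using r(2) by blast
    qed
  qed
  then show ?thesis
    using metrizable_space_mtopology by simp
qed

corollary Frechet_Urysohn_imp_metrizable:
  assumes "Hausdorff_space T" "Frechet_Urysohn_space T" "countable_cs_star_character T"
  shows "metrizable_space T"
proof -
  obtain \<N> where "countable \<N>" "cs_star_network_at T \<one> \<N>"
    using assms(3) one_in_topspace unfolding countable_cs_star_character_def by blast
  then obtain \<B> where "countable \<B>" "\<And>V. V \<in> \<B> \<Longrightarrow> openin T V"
      "\<And>U. openin T U \<Longrightarrow> \<one> \<in> U \<Longrightarrow> \<exists>V\<in>\<B>. \<one> \<in> V \<and> V \<subseteq> U"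
    using countable_base_at_one[OF assms(1,2)] by metis
  then show ?thesis
    using Birkhoff_Kakutani[OF assms(1)] by metis
qed

end

subsection \<open>The cs*-character of the compact-open topology\<close>

text \<open>For compact \<open>A\<close> and open \<open>B\<close> these are the subbasic open sets;
  the cs*-network uses the same form with sets that need be neither.\<close>

definition maps_into :: "'a topology \<Rightarrow> 'b topology \<Rightarrow> 'a set \<Rightarrow> 'b set \<Rightarrow> ('a \<Rightarrow> 'b) set" where
  "maps_into X Y A B = {f \<in> continuous_functions X Y. f ` A \<subseteq> B}"

lemma openin_maps_into:
  "compactin X K \<Longrightarrow> openin Y U \<Longrightarrow> openin (compact_open_topology X Y) (maps_into X Y K U)"
  unfolding compact_open_topology_def maps_into_def by (rule topology_generated_by_Basis) auto

lemma limitin_compact_open_eventually: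
  assumes "limitin (compact_open_topology X Y) s f F" "compactin X K" "openin Y U" "f ` K \<subseteq> U"
  shows "\<forall>\<^sub>F n in F. s n ` K \<subseteq> U"
proof -
  have "f \<in> maps_into X Y K U"
    using limitin_topspace[OF assms(1)] assms(4) by (simp add: maps_into_def)
  then have "\<forall>\<^sub>F n in F. s n \<in> maps_into X Y K U"
    by (rule limitinD[OF assms(1) openin_maps_into[OF assms(2,3)]])
  then show ?thesis
    by (rule eventually_mono) (simp add: maps_into_def)
qed

lemma compactin_Un_sequence:
  fixes L :: "nat \<Rightarrow> 'a set"
  assumes K: "compactin X K" and L: "\<And>n. j \<le> n \<Longrightarrow> compactin X (L n)"
    and conv: "\<And>U. openin X U \<Longrightarrow> K \<subseteq> U \<Longrightarrow> \<forall>\<^sub>F n in sequentially. L n \<subseteq> U"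
  shows "compactin X (K \<union> (\<Union>n\<in>{j..}. L n))"
  unfolding compactin_def
proof (intro conjI allI impI)
  show "K \<union> (\<Union>n\<in>{j..}. L n) \<subseteq> topspace X"
    using K L compactin_subset_topspace by fastforce
  fix \<U> assume \<U>: "(\<forall>U\<in>\<U>. openin X U) \<and> K \<union> (\<Union>n\<in>{j..}. L n) \<subseteq> \<Union>\<U>"
  then obtain \<F> where \<F>: "finite \<F>" "\<F> \<subseteq> \<U>" "K \<subseteq> \<Union>\<F>"
    using compactinD[OF K, of \<U>] by auto
  then have "openin X (\<Union>\<F>)"
    using \<U> by blast
  then obtain m where m: "\<And>n. m \<le> n \<Longrightarrow> L n \<subseteq> \<Union>\<F>"
    using conv[OF _ \<F>(3)] unfolding eventually_sequentially by blast
  have "compactin X (\<Union>n\<in>{j..<m}. L n)"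
    using L by (intro compactin_Union) auto
  moreover have "(\<Union>n\<in>{j..<m}. L n) \<subseteq> \<Union>\<U>"
    using \<U> by fastforce
  ultimately obtain \<G> where \<G>: "finite \<G>" "\<G> \<subseteq> \<U>" "(\<Union>n\<in>{j..<m}. L n) \<subseteq> \<Union>\<G>"
    using compactinD[of X _ \<U>] \<U> by metis
  have "L n \<subseteq> \<Union>(\<F> \<union> \<G>)" if "j \<le> n" for n
  proof (cases "m \<le> n")
    case True
    then show ?thesis
      using m by blast
  next
    case False
    then have "n \<in> {j..<m}"
      using that by simp
    then show ?thesis
      using \<G>(3) by blast
  qed
  then have "K \<union> (\<Union>n\<in>{j..}. L n) \<subseteq> \<Union>(\<F> \<union> \<G>)"
    using \<F>(3) by auto
  then show "\<exists>\<F>. finite \<F> \<and> \<F> \<subseteq> \<U> \<and> K \<union> (\<Union>n\<in>{j..}. L n) \<subseteq> \<Union>\<F>"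
    using \<F> \<G> by (intro exI[of _ "\<F> \<union> \<G>"]) auto
qed

text \<open>A space with a countable network is Lindelof, and so is its image under \<open>f\<close>.\<close>

lemma locally_finite_countable_near_image:
  assumes "countable \<P>" "k_network_in X \<P>" "continuous_map X Y f" "locally_finite_in Y \<A>"
  obtains W where "openin Y W" "f ` topspace X \<subseteq> W" "countable {A \<in> \<A>. A \<inter> W \<noteq> {}}"
proof -
  \<comment> \<open>The countably many network members whose image has a neighbourhood meeting only
    finitely many sets of \<open>\<A>\<close>. They cover the space: local finiteness at
    \<open>f x\<close> and the k-network at the compact set \<open>{x}\<close> produce one
    containing \<open>x\<close>.\<close>
  define D where "D = {P \<in> \<P>. \<exists>V. openin Y V \<and> f ` P \<subseteq> V \<and> finite {A \<in> \<A>. A \<inter> V \<noteq> {}}}"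
  have "\<forall>P\<in>D. \<exists>V. openin Y V \<and> f ` P \<subseteq> V \<and> finite {A \<in> \<A>. A \<inter> V \<noteq> {}}"
    by (simp add: D_def)
  then obtain V where "\<forall>P\<in>D. openin Y (V P) \<and> f ` P \<subseteq> V P \<and> finite {A \<in> \<A>. A \<inter> V P \<noteq> {}}"
    by (rule bchoice[THEN exE])
  then have V: "openin Y (V P)" "f ` P \<subseteq> V P" "finite {A \<in> \<A>. A \<inter> V P \<noteq> {}}" if "P \<in> D" for P
    using that by auto
  show thesis
  proof (rule that[of "\<Union>P\<in>D. V P"])
    show "openin Y (\<Union>P\<in>D. V P)"
      using V(1) by blast
    have "countable (\<Union>P\<in>D. {A \<in> \<A>. A \<inter> V P \<noteq> {}})"
      using assms(1) V(3) by (intro countable_UN) (auto simp: D_def intro: countable_finite)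
    then show "countable {A \<in> \<A>. A \<inter> (\<Union>P\<in>D. V P) \<noteq> {}}"
      by (rule countable_subset[rotated]) blast
    show "f ` topspace X \<subseteq> (\<Union>P\<in>D. V P)"
    proof (rule image_subsetI)
      fix x assume x: "x \<in> topspace X"
      then have "f x \<in> topspace Y"
        using assms(3) continuous_map_image_subset_topspace by fastforce
      then obtain O' where O': "openin Y O'" "f x \<in> O'" "finite {A \<in> \<A>. A \<inter> O' \<noteq> {}}"
        using assms(4) unfolding locally_finite_in_def by blast
      have "openin X {x \<in> topspace X. f x \<in> O'}"
        using assms(3) O'(1) by (rule openin_continuous_map_preimage)
      moreover have "compactin X {x}" "{x} \<subseteq> {x \<in> topspace X. f x \<in> O'}"
        using x O' by auto
      ultimately obtain \<F> where \<F>: "\<F> \<subseteq> \<P>" "{x} \<subseteq> \<Union>\<F>" "\<Union>\<F> \<subseteq> {x \<in> topspace X. f x \<in> O'}"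
        using assms(2) unfolding k_network_in_def by meson
      then obtain P where "P \<in> \<F>" "x \<in> P"
        by auto
      moreover from this have "f ` P \<subseteq> O'"
        using \<F>(3) by auto
      ultimately have "P \<in> D"
        using O' \<F>(1) by (auto simp: D_def)
      then show "f x \<in> (\<Union>P\<in>D. V P)"
        using V(2) \<open>x \<in> P\<close> by blast
    qed
  qed
qed

text \<open>Finite unions from the k-network supply sets between \<open>K\<close> and any open set
  around it. Intersecting initial segments of an enumeration of those that contain \<open>K\<close>
  makes them decrease without leaving a countable family.\<close>

lemma countable_decreasing_k_network:
  assumes "countable \<P>" "k_network_in X \<P>"
  obtains \<P>' where "countable \<P>'"
    "\<And>K. compactin X K \<Longrightarrow> \<exists>P :: nat \<Rightarrow> 'a set. range P \<subseteq> \<P>' \<and> decseq P \<and> (\<forall>i. K \<subseteq> P i \<and> P i \<subseteq> topspace X) \<and>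
      (\<forall>U. openin X U \<and> K \<subseteq> U \<longrightarrow> (\<exists>i. P i \<subseteq> U))"
proof -
  define \<P>1 where "\<P>1 = Union ` {\<F>. finite \<F> \<and> \<F> \<subseteq> \<P>}"
  define \<P>2 where "\<P>2 = Inter ` {\<F>. finite \<F> \<and> \<F> \<subseteq> \<P>1}"
  have "countable \<P>1"
    using assms(1) by (simp add: \<P>1_def countable_Collect_finite_subset)
  then have "countable \<P>2"
    by (simp add: \<P>2_def countable_Collect_finite_subset)
  moreover have "\<exists>P :: nat \<Rightarrow> 'a set. range P \<subseteq> \<P>2 \<and> decseq P \<and> (\<forall>i. K \<subseteq> P i \<and> P i \<subseteq> topspace X) \<and>
      (\<forall>U. openin X U \<and> K \<subseteq> U \<longrightarrow> (\<exists>i. P i \<subseteq> U))" if K: "compactin X K" for K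
  proof -
    have ex: "\<exists>Q\<in>{Q \<in> \<P>1. K \<subseteq> Q}. Q \<subseteq> U" if U: "openin X U" "K \<subseteq> U" for U
    proof -
      obtain \<F> where "finite \<F>" "\<F> \<subseteq> \<P>" "K \<subseteq> \<Union>\<F>" "\<Union>\<F> \<subseteq> U"
        using assms(2) K U unfolding k_network_in_def by meson
      then show ?thesis
        unfolding \<P>1_def by blast
    qed
    have "{Q \<in> \<P>1. K \<subseteq> Q} \<noteq> {}"
      using ex[of "topspace X"] compactin_subset_topspace[OF K] by auto
    moreover have "countable {Q \<in> \<P>1. K \<subseteq> Q}"
      using \<open>countable \<P>1\<close> by simp
    ultimately obtain Q :: "nat \<Rightarrow> 'a set" where Q: "range Q = {Q \<in> \<P>1. K \<subseteq> Q}"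
      by (metis range_from_nat_into)
    define P where "P i = \<Inter>(Q ` {..i})" for i
    have "Q ` {..i} \<subseteq> \<P>1" for i
      using Q by blast
    then have "range P \<subseteq> \<P>2"
      unfolding P_def \<P>2_def by auto
    moreover have "decseq P"
      unfolding P_def by (intro antimonoI INF_superset_mono) auto
    moreover have "K \<subseteq> P i" for i
      using Q unfolding P_def by blast
    moreover have "P i \<subseteq> topspace X" for i
    proof -
      have "Q i \<in> \<P>1"
        using Q by blast
      then obtain \<F> where "Q i = \<Union>\<F>" "\<F> \<subseteq> \<P>"
        by (auto simp: \<P>1_def)
      then have "Q i \<subseteq> topspace X"
        using assms(2) by (auto simp: k_network_in_def)
      then show ?thesis
        unfolding P_def by blast
    qed
    moreover have "\<exists>i. P i \<subseteq> U" if U: "openin X U" "K \<subseteq> U" for U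
    proof -
      obtain i where "Q i \<subseteq> U"
        using ex[OF U] Q by (metis (no_types, lifting) imageE)
      then show ?thesis
        unfolding P_def by blast
    qed
    ultimately show ?thesis
      by (intro exI[of _ P]) simp
  qed
  ultimately show thesis
    by (rule that)
qed

section \<open>Absorbing families in the range\<close>

lemma Union_finite_Unions:
  assumes "finite \<R>" "\<R> \<subseteq> Union ` {\<F>. finite \<F> \<and> \<F> \<subseteq> \<C>}"
  shows "\<Union>\<R> \<in> Union ` {\<F>. finite \<F> \<and> \<F> \<subseteq> \<C>}"
proof -
  obtain \<Z> where \<Z>: "\<Z> \<subseteq> {\<F>. finite \<F> \<and> \<F> \<subseteq> \<C>}" "finite \<Z>" "\<R> = Union ` \<Z>"
    using finite_subset_image[OF assms] by blast
  have "\<Union>\<Z> \<in> {\<F>. finite \<F> \<and> \<F> \<subseteq> \<C>}"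
    using \<Z>(1,2) by auto
  moreover have "\<Union>\<R> = \<Union>(\<Union>\<Z>)"
    using \<Z>(3) by auto
  ultimately show ?thesis
    by (rule rev_image_eqI)
qed

text \<open>In the range only the countably many members of each locally finite family that meet a
  neighbourhood of the image of \<open>f\<close> matter for maps that are close to \<open>f\<close>.\<close>

lemma countable_absorbing_family:
  assumes \<P>: "countable \<P>" "k_network_in X \<P>" and "aleph_space Y" and f: "f \<in> continuous_functions X Y"
  obtains \<Q> where "countable \<Q>" "\<And>\<R>. finite \<R> \<Longrightarrow> \<R> \<subseteq> \<Q> \<Longrightarrow> \<Union>\<R> \<in> \<Q>"
    "\<And>s K U. limitin (compact_open_topology X Y) s f sequentially \<Longrightarrow> range s \<subseteq> continuous_functions X Y \<Longrightarrow>
      compactin X K \<Longrightarrow> openin Y U \<Longrightarrow> f ` K \<subseteq> U \<Longrightarrow>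
      \<exists>Q\<in>\<Q>. Q \<subseteq> U \<and> (\<forall>\<^sub>F n in sequentially. s n ` K \<subseteq> Q)"
proof -
  have cont: "continuous_map X Y f"
    using f by (simp add: continuous_functions_def)
  obtain \<A> :: "nat \<Rightarrow> 'b set set" where \<A>: "\<And>m. locally_finite_in Y (\<A> m)" "k_network_in Y (\<Union>m. \<A> m)"
    using assms(3) unfolding aleph_space_def sigma_locally_finite_in_def by metis
  have "\<exists>W. openin Y W \<and> f ` topspace X \<subseteq> W \<and> countable {A \<in> \<A> m. A \<inter> W \<noteq> {}}" for m
    using locally_finite_countable_near_image[OF \<P> cont \<A>(1)] by metis
  then obtain W where W: "\<And>m. openin Y (W m)" "\<And>m. f ` topspace X \<subseteq> W m"
      "\<And>m. countable {A \<in> \<A> m. A \<inter> W m \<noteq> {}}"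
    by metis
  define \<C> where "\<C> = (\<Union>m. {A \<in> \<A> m. A \<inter> W m \<noteq> {}})"
  have "countable \<C>"
    unfolding \<C>_def using W(3) by (intro countable_UN) auto
  show thesis
  proof (rule that[of "Union ` {\<F>. finite \<F> \<and> \<F> \<subseteq> \<C>}"])
    show "countable (Union ` {\<F>. finite \<F> \<and> \<F> \<subseteq> \<C>})"
      using \<open>countable \<C>\<close> by (intro countable_image countable_Collect_finite_subset)
    show "\<Union>\<R> \<in> Union ` {\<F>. finite \<F> \<and> \<F> \<subseteq> \<C>}"
      if "finite \<R>" "\<R> \<subseteq> Union ` {\<F>. finite \<F> \<and> \<F> \<subseteq> \<C>}" for \<R>
      using that by (rule Union_finite_Unions)
    fix s K U
    assume s: "limitin (compact_open_topology X Y) s f sequentially" "range s \<subseteq> continuous_functions X Y"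
      and K: "compactin X K" and U: "openin Y U" "f ` K \<subseteq> U"
    have s_cont: "continuous_map X Y (s n)" for n
      using s(2) unfolding continuous_functions_def by blast
    obtain n0 where n0: "\<And>n. n0 \<le> n \<Longrightarrow> s n ` K \<subseteq> U"
      using limitin_compact_open_eventually[OF s(1) K U] unfolding eventually_sequentially by blast
    let ?L = "f ` K \<union> (\<Union>n\<in>{n0..}. s n ` K)"
    have "compactin Y ?L"
      using limitin_compact_open_eventually[OF s(1) K]
      by (intro compactin_Un_sequence image_compactin[OF K] cont s_cont)
    moreover have "?L \<subseteq> U"
      using U n0 by auto
    ultimately obtain \<F> where \<F>: "finite \<F>" "\<F> \<subseteq> (\<Union>m. \<A> m)" "?L \<subseteq> \<Union>\<F>" "\<Union>\<F> \<subseteq> U"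
      using \<A>(2) U(1) unfolding k_network_in_def by meson
    obtain m where m: "\<And>F. F \<in> \<F> \<Longrightarrow> F \<in> \<A> (m F)"
      using \<F>(2) by (metis UN_iff subsetD)
    have fK: "f ` K \<subseteq> W (m F)" for F
      using W(2)[of "m F"] compactin_subset_topspace[OF K] by blast
    let ?\<F> = "{F \<in> \<F>. F \<inter> W (m F) \<noteq> {}}"
    have "?\<F> \<subseteq> \<C>"
      using m by (auto simp: \<C>_def)
    then have "\<Union>?\<F> \<in> Union ` {\<F>. finite \<F> \<and> \<F> \<subseteq> \<C>}"
      using \<F>(1) by (intro imageI) simp
    moreover have "\<Union>?\<F> \<subseteq> U"
      using \<F>(4) by blast
    moreover have "\<forall>\<^sub>F n in sequentially. \<forall>F\<in>\<F>. s n ` K \<subseteq> W (m F)"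
      using \<F>(1) limitin_compact_open_eventually[OF s(1) K W(1) fK] by (intro eventually_ball_finite) auto
    then have "\<forall>\<^sub>F n in sequentially. s n ` K \<subseteq> \<Union>?\<F>"
      using eventually_ge_at_top[of n0]
    proof eventually_elim
      case (elim n)
      show ?case
      proof
        fix y assume y: "y \<in> s n ` K"
        then have "y \<in> ?L"
          using elim(2) by auto
        with \<F>(3) have "y \<in> \<Union>\<F>"
          by (rule subsetD)
        then obtain F where "F \<in> \<F>" "y \<in> F"
          by (rule UnionE)
        moreover from this have "y \<in> W (m F)"
          using elim(1) y by blast
        ultimately show "y \<in> \<Union>?\<F>"
          by (intro UnionI[of F]) auto
      qed
    qed
    ultimately show "\<exists>Q\<in>Union ` {\<F>. finite \<F> \<and> \<F> \<subseteq> \<C>}. Q \<subseteq> U \<and> (\<forall>\<^sub>F n in sequentially. s n ` K \<subseteq> Q)"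
      by (intro bexI[of _ "\<Union>?\<F>"] conjI)
  qed
qed

text \<open>Otherwise there are points \<open>x i \<in> P i\<close>, which converge to \<open>K\<close>, with values outside the growing
  unions; but \<open>K\<close> together with a tail of the points \<open>x i\<close> is compact.\<close>

lemma eventually_maps_into_absorbing:
  assumes f: "continuous_map X Y f"
    and P: "decseq P" "\<And>i. K \<subseteq> P i" "\<And>i :: nat. P i \<subseteq> topspace X"
      "\<And>U. openin X U \<Longrightarrow> K \<subseteq> U \<Longrightarrow> \<exists>i. P i \<subseteq> U"
    and K: "compactin X K" and U: "openin Y U" "f ` K \<subseteq> U"
    and R: "\<And>K. compactin X K \<Longrightarrow> f ` K \<subseteq> U \<Longrightarrow> \<exists>k :: nat. \<forall>\<^sub>F n in sequentially. t n ` K \<subseteq> R k"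
  shows "\<exists>i. \<forall>\<^sub>F n in sequentially. t n ` P i \<subseteq> \<Union>(R ` {..i})"
proof (rule ccontr)
  assume contr: "\<not> (\<exists>i. \<forall>\<^sub>F n in sequentially. t n ` P i \<subseteq> \<Union>(R ` {..i}))"
  have "\<exists>n x. i \<le> n \<and> x \<in> P i \<and> t n x \<notin> \<Union>(R ` {..i})" for i
    using contr unfolding eventually_sequentially by (metis image_subsetI)
  then obtain n x where nx: "\<And>i. i \<le> n i" "\<And>i. x i \<in> P i" "\<And>i. t (n i) (x i) \<notin> \<Union>(R ` {..i})"
    by metis
  have "openin X {x \<in> topspace X. f x \<in> U}"
    using f U(1) by (rule openin_continuous_map_preimage)
  moreover have "K \<subseteq> {x \<in> topspace X. f x \<in> U}"
    using U(2) compactin_subset_topspace[OF K] by auto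
  ultimately obtain j where j: "P j \<subseteq> {x \<in> topspace X. f x \<in> U}"
    using P(4) by meson
  let ?K = "K \<union> (\<Union>i\<in>{j..}. {x i})"
  have "\<forall>\<^sub>F i in sequentially. {x i} \<subseteq> V" if V: "openin X V" "K \<subseteq> V" for V
  proof -
    obtain i where "P i \<subseteq> V"
      using P(4)[OF V] by blast
    then have "x k \<in> V" if "i \<le> k" for k
      using nx(2)[of k] decseqD[OF P(1) that] by blast
    then show ?thesis
      unfolding eventually_sequentially by auto
  qed
  moreover have "compactin X {x i}" for i
    using nx(2)[of i] P(3)[of i] by auto
  ultimately have "compactin X ?K"
    using K by (intro compactin_Un_sequence)
  moreover have "f (x i) \<in> U" if "j \<le> i" for i
    using nx(2)[of i] decseqD[OF P(1) that] j by blast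
  then have "f ` ?K \<subseteq> U"
    using U(2) by auto
  ultimately obtain k n1 where n1: "\<And>n. n1 \<le> n \<Longrightarrow> t n ` ?K \<subseteq> R k"
    using R[of ?K] unfolding eventually_sequentially by blast
  \<comment> \<open>Large enough for three things at once: \<open>n i\<close> is past
    \<open>n1\<close>, \<open>x i\<close> belongs to the tail in \<open>?K\<close>, and
    \<open>R k\<close> is among the sets that \<open>t (n i) (x i)\<close> avoids.\<close>
  define i where "i = max n1 (max j k)"
  have "x i \<in> ?K"
    by (auto simp: i_def)
  moreover have "n1 \<le> n i"
    using nx(1)[of i] by (simp add: i_def)
  ultimately have "t (n i) (x i) \<in> R k"
    using n1[of "n i"] by blast
  moreover have "R k \<subseteq> \<Union>(R ` {..i})"
    by (intro Union_upper imageI) (simp add: i_def)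
  ultimately show False
    using nx(3) by blast
qed

text \<open>Finite intersections of sets \<open>maps_into X Y P Q\<close> form the network. A
  sequence converging to \<open>f\<close> even ends up inside a suitable member, which is stronger
  than meeting it infinitely often.\<close>

theorem countable_cs_star_character_compact_open:
  assumes "aleph0_space X" "aleph_space Y"
  shows "countable_cs_star_character (compact_open_topology X Y)"
  unfolding countable_cs_star_character_def topspace_compact_open_topology
proof
  fix f assume f: "f \<in> continuous_functions X Y"
  then have cont: "continuous_map X Y f"
    by (simp add: continuous_functions_def)
  let ?T = "compact_open_topology X Y"
  obtain \<P> where \<P>: "countable \<P>" "k_network_in X \<P>"
    using assms(1) unfolding aleph0_space_def by blast
  obtain \<P>' where \<P>': "countable \<P>'"
    "\<And>K. compactin X K \<Longrightarrow> \<exists>P :: nat \<Rightarrow> 'a set. range P \<subseteq> \<P>' \<and> decseq P \<and> (\<forall>i. K \<subseteq> P i \<and> P i \<subseteq> topspace X) \<and>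
      (\<forall>U. openin X U \<and> K \<subseteq> U \<longrightarrow> (\<exists>i. P i \<subseteq> U))"
    using countable_decreasing_k_network[OF \<P>] by metis
  obtain \<Q> where "countable \<Q>" and \<Q>_Union: "\<And>\<R>. finite \<R> \<Longrightarrow> \<R> \<subseteq> \<Q> \<Longrightarrow> \<Union>\<R> \<in> \<Q>"
    and absorb: "\<And>s K U. limitin ?T s f sequentially \<Longrightarrow> range s \<subseteq> continuous_functions X Y \<Longrightarrow>
      compactin X K \<Longrightarrow> openin Y U \<Longrightarrow> f ` K \<subseteq> U \<Longrightarrow>
      \<exists>Q\<in>\<Q>. Q \<subseteq> U \<and> (\<forall>\<^sub>F n in sequentially. s n ` K \<subseteq> Q)"
    using countable_absorbing_family[OF \<P> assms(2) f] by metis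
  have sub: "\<exists>P\<in>\<P>'. \<exists>Q\<in>\<Q>. K \<subseteq> P \<and> Q \<subseteq> U \<and> f ` P \<subseteq> Q \<and> (\<forall>\<^sub>F n in sequentially. s n ` P \<subseteq> Q)"
    if s: "limitin ?T s f sequentially" "range s \<subseteq> continuous_functions X Y"
      and K: "compactin X K" and U: "openin Y U" "f ` K \<subseteq> U" for s K U
  proof -
    obtain P where P: "range P \<subseteq> \<P>'" "decseq P" "\<And>i. K \<subseteq> P i" "\<And>i :: nat. P i \<subseteq> topspace X"
        "\<And>U. openin X U \<Longrightarrow> K \<subseteq> U \<Longrightarrow> \<exists>i. P i \<subseteq> U"
      using \<P>'(2)[OF K] by metis
    have "{Q \<in> \<Q>. Q \<subseteq> U} \<noteq> {}"
      using absorb[OF s K U] by blast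
    moreover have "countable {Q \<in> \<Q>. Q \<subseteq> U}"
      using \<open>countable \<Q>\<close> by simp
    ultimately obtain R :: "nat \<Rightarrow> 'b set" where R: "range R = {Q \<in> \<Q>. Q \<subseteq> U}"
      by (metis range_from_nat_into)
    define Q where "Q i = \<Union>(R ` {..i})" for i
    have "R ` {..i} \<subseteq> \<Q>" for i
      using R by blast
    then have Q: "Q i \<in> \<Q>" "Q i \<subseteq> U" for i
      using R unfolding Q_def by (auto intro!: \<Q>_Union)
    have "incseq Q"
      unfolding Q_def by (intro monoI SUP_subset_mono) auto
    \<comment> \<open>Stated for arbitrary \<open>t\<close> so that the constant sequence at
      \<open>f\<close> can be inserted too, which puts \<open>f\<close> itself into the set
      found.\<close>
    have ex: "\<exists>i. \<forall>\<^sub>F n in sequentially. t n ` P i \<subseteq> Q i"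
      if t: "limitin ?T t f sequentially" "range t \<subseteq> continuous_functions X Y" for t
      unfolding Q_def
    proof (rule eventually_maps_into_absorbing[OF cont P(2-5) K U])
      fix K assume "compactin X K" "f ` K \<subseteq> U"
      then obtain Q where "Q \<in> range R" "\<forall>\<^sub>F n in sequentially. t n ` K \<subseteq> Q"
        using absorb[OF t _ U(1), of K] R by auto
      then show "\<exists>k. \<forall>\<^sub>F n in sequentially. t n ` K \<subseteq> R k"
        by auto
    qed
    obtain i1 where i1: "\<forall>\<^sub>F n in sequentially. s n ` P i1 \<subseteq> Q i1"
      using ex[OF s] by blast
    obtain i2 where i2: "f ` P i2 \<subseteq> Q i2"
      using ex[of "\<lambda>_. f"] f by auto
    \<comment> \<open>Both inclusions survive at the maximum because \<open>P\<close> decreases and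
      \<open>Q\<close> increases.\<close>
    define i where "i = max i1 i2"
    have le: "P i \<subseteq> P i1" "P i \<subseteq> P i2" "Q i1 \<subseteq> Q i" "Q i2 \<subseteq> Q i"
      using decseqD[OF P(2)] incseqD[OF \<open>incseq Q\<close>] by (simp_all add: i_def)
    have "f ` P i \<subseteq> Q i"
      using i2 le by blast
    moreover have "\<forall>\<^sub>F n in sequentially. s n ` P i \<subseteq> Q i"
      using i1 by (rule eventually_mono) (use le in blast)
    moreover have "P i \<in> \<P>'"
      using P(1) by blast
    ultimately show ?thesis
      using P(3)[of i] Q[of i] by blast
  qed
  define \<S> where "\<S> = (\<lambda>(P, Q). maps_into X Y P Q) ` (\<P>' \<times> \<Q>)"
  \<comment> \<open>Intersecting with the whole function space matters for the empty
    \<open>\<F>\<close>, whose \<open>\<Inter>\<close> is \<open>UNIV\<close>.\<close>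
  define \<N> where "\<N> = (\<lambda>\<F>. continuous_functions X Y \<inter> \<Inter>\<F>) ` {\<F>. finite \<F> \<and> \<F> \<subseteq> \<S>}"
  have "countable \<S>"
    using \<P>'(1) \<open>countable \<Q>\<close> by (simp add: \<S>_def)
  then have "countable \<N>"
    by (simp add: \<N>_def countable_Collect_finite_subset)
  moreover have "\<exists>N\<in>\<N>. f \<in> N \<and> N \<subseteq> V \<and> (\<forall>\<^sub>F n in sequentially. s n \<in> N)"
    if s: "limitin ?T s f sequentially" "range s \<subseteq> continuous_functions X Y" and V: "openin ?T V" "f \<in> V" for s V
  proof -
    \<comment> \<open>Induction on the generation of \<open>V\<close> reduces the claim to subbasic
      sets, where \<open>sub\<close> applies; the intersection case is the reason for finite
      intersections in \<open>\<N>\<close>.\<close>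
    have "generate_topology_on {{f \<in> continuous_functions X Y. f ` K \<subseteq> U} | K U. compactin X K \<and> openin Y U} V"
      using V(1) unfolding compact_open_topology_def by (rule openin_topology_generated_by)
    then show ?thesis
      using V(2)
    proof (induction rule: generate_topology_on.induct)
      case (Int A B)
      then obtain M N where MN: "M \<in> \<N>" "f \<in> M" "M \<subseteq> A" "\<forall>\<^sub>F n in sequentially. s n \<in> M"
          "N \<in> \<N>" "f \<in> N" "N \<subseteq> B" "\<forall>\<^sub>F n in sequentially. s n \<in> N"
        by blast
      then obtain \<F> \<G> where "M = continuous_functions X Y \<inter> \<Inter>\<F>" "finite \<F>" "\<F> \<subseteq> \<S>"
          "N = continuous_functions X Y \<inter> \<Inter>\<G>" "finite \<G>" "\<G> \<subseteq> \<S>"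
        by (auto simp: \<N>_def)
      then have "M \<inter> N = continuous_functions X Y \<inter> \<Inter>(\<F> \<union> \<G>)" "\<F> \<union> \<G> \<in> {\<F>. finite \<F> \<and> \<F> \<subseteq> \<S>}"
        by auto
      then have "M \<inter> N \<in> \<N>"
        unfolding \<N>_def by (rule image_eqI)
      moreover have "\<forall>\<^sub>F n in sequentially. s n \<in> M \<inter> N"
        using eventually_conj[OF MN(4,8)] by simp
      ultimately show ?case
        using MN by (intro bexI[of _ "M \<inter> N"]) auto
    next
      case (UN \<K>)
      then obtain k where "k \<in> \<K>" "f \<in> k"
        by blast
      then show ?case
        using UN.IH[of k] by blast
    next
      case (Basis B)
      then obtain K U where B: "B = maps_into X Y K U" "compactin X K" "openin Y U"
        unfolding maps_into_def by blast
      then have "f ` K \<subseteq> U"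
        using Basis.prems by (simp add: maps_into_def)
      then obtain P Q where PQ: "P \<in> \<P>'" "Q \<in> \<Q>" "K \<subseteq> P" "Q \<subseteq> U" "f ` P \<subseteq> Q"
          "\<forall>\<^sub>F n in sequentially. s n ` P \<subseteq> Q"
        using sub[OF s B(2,3)] by blast
      let ?N = "maps_into X Y P Q"
      have "?N \<in> \<S>"
        unfolding \<S>_def using PQ(1,2) by (intro image_eqI[of _ _ "(P, Q)"]) auto
      moreover have "?N = continuous_functions X Y \<inter> \<Inter>{?N}"
        by (auto simp: maps_into_def)
      ultimately have "?N \<in> \<N>"
        unfolding \<N>_def by (intro image_eqI[of _ _ "{?N}"]) simp_all
      moreover have "f \<in> ?N"
        using f PQ(5) by (simp add: maps_into_def)
      moreover have "?N \<subseteq> B"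
        using PQ(3,4) unfolding B(1) maps_into_def by blast
      moreover have "\<forall>\<^sub>F n in sequentially. s n \<in> ?N"
        using PQ(6) by (rule eventually_mono) (use s(2) in \<open>auto simp: maps_into_def\<close>)
      ultimately show ?case
        by blast
    qed simp
  qed
  then have "cs_star_network_at ?T f \<N>"
    unfolding cs_star_network_at_def topspace_compact_open_topology
  proof (intro conjI allI impI ballI, goal_cases)
    case (1 N)
    then show ?case
      by (auto simp: \<N>_def)
  next
    case (2 s V W)
    then obtain N where N: "N \<in> \<N>" "f \<in> N" "N \<subseteq> V" "\<forall>\<^sub>F n in sequentially. s n \<in> N"
      by metis
    then have "infinite {n. s n \<in> N}"
      by (metis eventually_frequently frequently_cofinite cofinite_eq_sequentially trivial_limit_sequentially)
    then show ?case
      using N 2 by (intro bexI[of _ N]) auto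
  qed
  ultimately show "\<exists>\<N>. countable \<N> \<and> cs_star_network_at ?T f \<N>"
    by blast
qed

subsection \<open>The topological group of continuous functions\<close>

text \<open>By extensionality distinct elements differ at a point \<open>x\<close> of the space, and
  the compact set \<open>{x}\<close> carries disjoint neighbourhoods of the two values over to the
  maps.\<close>

lemma Hausdorff_space_compact_open:
  assumes "Hausdorff_space Y"
  shows "Hausdorff_space (compact_open_topology X Y)"
  unfolding Hausdorff_space_def topspace_compact_open_topology
proof (intro allI impI, elim conjE)
  fix f g assume f: "f \<in> continuous_functions X Y" and g: "g \<in> continuous_functions X Y" and "f \<noteq> g"
  then obtain x where x: "x \<in> topspace X" "f x \<noteq> g x"
    unfolding continuous_functions_def by (metis (no_types, lifting) extensionalityI mem_Collect_eq)
  then have "f x \<in> topspace Y" "g x \<in> topspace Y"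
    using f g continuous_map_image_subset_topspace unfolding continuous_functions_def by fastforce+
  then obtain U V where UV: "openin Y U" "openin Y V" "f x \<in> U" "g x \<in> V" "disjnt U V"
    using assms x(2) unfolding Hausdorff_space_def by metis
  have "openin (compact_open_topology X Y) (maps_into X Y {x} U)"
    "openin (compact_open_topology X Y) (maps_into X Y {x} V)"
    using UV x by (auto intro!: openin_maps_into)
  moreover have "f \<in> maps_into X Y {x} U" "g \<in> maps_into X Y {x} V"
    "disjnt (maps_into X Y {x} U) (maps_into X Y {x} V)"
    using f g UV by (auto simp: maps_into_def disjnt_iff)
  ultimately show "\<exists>U V. openin (compact_open_topology X Y) U \<and> openin (compact_open_topology X Y) V \<and>
      f \<in> U \<and> g \<in> V \<and> disjnt U V"
    by blast
qed

section \<open>Continuity of pointwise operations\<close>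

lemma continuous_functions_pointwise:
  assumes h: "continuous_map (prod_topology Y Z) W (\<lambda>(a, b). h a b)"
    and "f \<in> continuous_functions X Y" "g \<in> continuous_functions X Z"
  shows "restrict (\<lambda>x. h (f x) (g x)) (topspace X) \<in> continuous_functions X W"
proof -
  have "continuous_map X W ((\<lambda>(a, b). h a b) \<circ> (\<lambda>x. (f x, g x)))"
    using assms by (intro continuous_map_compose[OF _ h] continuous_map_pairedI) (auto simp: continuous_functions_def)
  then have "continuous_map X W (restrict (\<lambda>x. h (f x) (g x)) (topspace X))"
    by (rule continuous_map_eq) simp
  then show ?thesis
    by (simp add: continuous_functions_def)
qed

text \<open>Regularity shrinks the preimages of a product neighbourhood to closed sets, whose traces on a
  compact set are compact.\<close>

lemma continuous_map_pointwise:
  assumes X: "regular_space X" and h: "continuous_map (prod_topology Y Z) W (\<lambda>(a, b). h a b)"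
  shows "continuous_map (prod_topology (compact_open_topology X Y) (compact_open_topology X Z))
    (compact_open_topology X W) (\<lambda>(f, g). restrict (\<lambda>x. h (f x) (g x)) (topspace X))"
    (is "continuous_map (prod_topology ?TY ?TZ) _ ?H")
  unfolding compact_open_topology_def[of X W]
proof (rule continuous_on_generated_topo)
  have H: "?H p \<in> continuous_functions X W" if "p \<in> topspace (prod_topology ?TY ?TZ)" for p
    using that continuous_functions_pointwise[OF h] by auto
  have "continuous_functions X W \<in> {{f \<in> continuous_functions X W. f ` K \<subseteq> U} |K U. compactin X K \<and> openin W U}"
    by (rule CollectI, rule exI[of _ "{}"], rule exI[of _ "topspace W"]) auto
  then show "?H ` topspace (prod_topology ?TY ?TZ)
      \<subseteq> \<Union>{{f \<in> continuous_functions X W. f ` K \<subseteq> U} |K U. compactin X K \<and> openin W U}"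
    using H by blast
  fix N assume "N \<in> {{f \<in> continuous_functions X W. f ` K \<subseteq> U} |K U. compactin X K \<and> openin W U}"
  then obtain K U where N: "N = maps_into X W K U" and K: "compactin X K" and U: "openin W U"
    by (auto simp: maps_into_def)
  have KX: "K \<subseteq> topspace X"
    using K by (rule compactin_subset_topspace)
  have H_iff: "?H p \<in> N \<longleftrightarrow> (\<forall>x\<in>K. h (fst p x) (snd p x) \<in> U)"
    if "p \<in> topspace (prod_topology ?TY ?TZ)" for p
    using H[OF that] KX by (cases p) (auto simp: N maps_into_def image_subset_iff subset_iff)
  show "openin (prod_topology ?TY ?TZ) (?H -` N \<inter> topspace (prod_topology ?TY ?TZ))"
    unfolding openin_prod_topology_alt
  proof (intro allI impI)
    fix f g assume fg: "(f, g) \<in> ?H -` N \<inter> topspace (prod_topology ?TY ?TZ)"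
    then have f: "f \<in> continuous_functions X Y" and g: "g \<in> continuous_functions X Z"
      by auto
    have hU: "h (f x) (g x) \<in> U" if "x \<in> K" for x
      using fg H_iff[of "(f, g)"] that by simp
    have f_cont: "continuous_map X Y f" and g_cont: "continuous_map X Z g"
      using f g by (auto simp: continuous_functions_def)
    have "openin (prod_topology Y Z) {p \<in> topspace (prod_topology Y Z). (\<lambda>(a, b). h a b) p \<in> U}"
      using h U by (rule openin_continuous_map_preimage)
    note open_h = this[unfolded openin_prod_topology_alt, rule_format]
    \<comment> \<open>The open \<open>M\<close> is there for covering \<open>K\<close> by finitely
      many pieces; the closed \<open>C\<close> around it makes \<open>K \<inter> C\<close> compact,
      hence admissible in a subbasic set.\<close>
    have "\<exists>A B M C. openin Y A \<and> openin Z B \<and> (\<forall>a\<in>A. \<forall>b\<in>B. h a b \<in> U) \<and> openin X M \<and> closedin X C \<and>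
        x \<in> M \<and> M \<subseteq> C \<and> f ` C \<subseteq> A \<and> g ` C \<subseteq> B" if x: "x \<in> K" for x
    proof -
      have "(f x, g x) \<in> {p \<in> topspace (prod_topology Y Z). (\<lambda>(a, b). h a b) p \<in> U}"
        using hU[OF x] x KX f_cont g_cont by (auto simp: continuous_map_def Pi_iff)
      from open_h[OF this] obtain A B where AB: "openin Y A" "openin Z B" "f x \<in> A" "g x \<in> B"
          "A \<times> B \<subseteq> {p \<in> topspace (prod_topology Y Z). (\<lambda>(a, b). h a b) p \<in> U}"
        by (elim exE conjE)
      have "openin X ({y \<in> topspace X. f y \<in> A} \<inter> {y \<in> topspace X. g y \<in> B})"
        using f_cont g_cont AB by (intro openin_Int openin_continuous_map_preimage)
      moreover have "x \<in> {y \<in> topspace X. f y \<in> A} \<inter> {y \<in> topspace X. g y \<in> B}"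
        using AB x KX by auto
      ultimately obtain M C where "openin X M" "closedin X C" "x \<in> M" "M \<subseteq> C"
          "C \<subseteq> {y \<in> topspace X. f y \<in> A} \<inter> {y \<in> topspace X. g y \<in> B}"
        using X unfolding neighbourhood_base_of_closedin[symmetric] neighbourhood_base_of by meson
      then show ?thesis
        using AB by (intro exI[of _ A] exI[of _ B] exI[of _ M] exI[of _ C]) auto
    qed
    then have "\<forall>x\<in>K. \<exists>A B M C. openin Y A \<and> openin Z B \<and> (\<forall>a\<in>A. \<forall>b\<in>B. h a b \<in> U) \<and> openin X M \<and>
        closedin X C \<and> x \<in> M \<and> M \<subseteq> C \<and> f ` C \<subseteq> A \<and> g ` C \<subseteq> B"
      by (rule ballI)
    then obtain A B M C where *: "\<forall>x\<in>K. openin Y (A x) \<and> openin Z (B x) \<and> (\<forall>a\<in>A x. \<forall>b\<in>B x. h a b \<in> U) \<and>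
        openin X (M x) \<and> closedin X (C x) \<and> x \<in> M x \<and> M x \<subseteq> C x \<and> f ` C x \<subseteq> A x \<and> g ` C x \<subseteq> B x"
      unfolding bchoice_iff by (elim exE)
    have AB: "openin Y (A x)" "openin Z (B x)" "\<And>a b. a \<in> A x \<Longrightarrow> b \<in> B x \<Longrightarrow> h a b \<in> U"
      and MC: "openin X (M x)" "closedin X (C x)" "x \<in> M x" "M x \<subseteq> C x" "f ` C x \<subseteq> A x" "g ` C x \<subseteq> B x"
      if "x \<in> K" for x
      using bspec[OF * that] by auto
    have "K \<subseteq> \<Union>(M ` K)"
      using MC(3) by blast
    then obtain \<F> where "finite \<F>" "\<F> \<subseteq> M ` K" "K \<subseteq> \<Union>\<F>"
      using compactinD[OF K, of "M ` K"] MC(1) by blast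
    then obtain D where D: "D \<subseteq> K" "finite D" "K \<subseteq> (\<Union>x\<in>D. M x)"
      by (metis finite_subset_image)
    \<comment> \<open>The factor \<open>topspace ?TY\<close> keeps \<open>S\<close> within the
      function space even if \<open>D\<close> is empty; likewise for \<open>R\<close>.\<close>
    define S where "S = topspace ?TY \<inter> \<Inter>((\<lambda>x. maps_into X Y (K \<inter> C x) (A x)) ` D)"
    define R where "R = topspace ?TZ \<inter> \<Inter>((\<lambda>x. maps_into X Z (K \<inter> C x) (B x)) ` D)"
    have KC: "compactin X (K \<inter> C x)" if "x \<in> D" for x
      using K MC(2) D(1) that by (intro compact_Int_closedin) auto
    have fC: "f ` (K \<inter> C x) \<subseteq> A x" and gC: "g ` (K \<inter> C x) \<subseteq> B x" if "x \<in> D" for x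
      using MC(5,6)[of x] that D(1) by blast+
    have "openin ?TY S"
      unfolding S_def
      using D AB KC by (intro openin_Int_Inter openin_topspace) (auto intro!: openin_maps_into)
    moreover have "openin ?TZ R"
      unfolding R_def
      using D AB KC by (intro openin_Int_Inter openin_topspace) (auto intro!: openin_maps_into)
    moreover have "f \<in> S" "g \<in> R"
      using f g fC gC by (simp_all add: S_def R_def maps_into_def)
    moreover have "S \<times> R \<subseteq> ?H -` N \<inter> topspace (prod_topology ?TY ?TZ)"
    proof (rule subsetI, clarify)
      fix f' g' assume f': "f' \<in> S" and g': "g' \<in> R"
      then have top: "(f', g') \<in> topspace (prod_topology ?TY ?TZ)"
        by (simp add: S_def R_def)
      have "h (f' x) (g' x) \<in> U" if x: "x \<in> K" for x
      proof -
        obtain y where y: "y \<in> D" "x \<in> M y"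
          using x D(3) by blast
        then have "x \<in> K \<inter> C y"
          using x MC(4)[of y] D(1) by blast
        then have "f' x \<in> A y" "g' x \<in> B y"
          using f' g' y(1) by (auto simp: S_def R_def maps_into_def image_subset_iff)
        then show ?thesis
          using AB(3)[of y "f' x" "g' x"] y D(1) by auto
      qed
      then show "(f', g') \<in> ?H -` N \<inter> topspace (prod_topology ?TY ?TZ)"
        using top H_iff[OF top] by simp
    qed
    ultimately show "\<exists>S R. openin ?TY S \<and> openin ?TZ R \<and> f \<in> S \<and> g \<in> R \<and>
        S \<times> R \<subseteq> ?H -` N \<inter> topspace (prod_topology ?TY ?TZ)"
      by blast
  qed
qed

text \<open>The restrictions keep the results extensional. The class
  \<open>topological_group_add\<close> is additive in notation only and does not assume
  commutativity, so a multiplicative record fits.\<close>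

definition function_group :: "'a topology \<Rightarrow> ('a \<Rightarrow> 'g :: topological_group_add) monoid" where
  "function_group X = \<lparr>carrier = continuous_functions X euclidean,
     mult = \<lambda>f g. restrict (\<lambda>x. f x + g x) (topspace X),
     one = restrict (\<lambda>x. 0) (topspace X)\<rparr>"

lemma function_group_simps:
  "carrier (function_group X) = continuous_functions X euclidean"
  "f \<otimes>\<^bsub>function_group X\<^esub> g = restrict (\<lambda>x. f x + g x) (topspace X)"
  "\<one>\<^bsub>function_group X\<^esub> = restrict (\<lambda>x. 0) (topspace X)"
  by (simp_all add: function_group_def)

text \<open>Both operations are instances of \<open>continuous_map_pointwise\<close>. Inversion
  becomes one by treating negation as a binary map that ignores its second argument and composing
  with the diagonal.\<close>

lemma topological_group_compact_open:
  assumes "regular_space X"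
  shows "topological_group (function_group X :: ('a \<Rightarrow> 'g :: topological_group_add) monoid)
    (compact_open_topology X euclidean)"
proof -
  let ?G = "function_group X :: ('a \<Rightarrow> 'g) monoid"
  let ?T = "compact_open_topology X (euclidean :: 'g topology)"
  have add: "continuous_map (prod_topology euclidean euclidean) euclidean (\<lambda>(a :: 'g, b). a + b)"
    unfolding prod_topology_euclidean continuous_map_iff_continuous2 case_prod_unfold
    by (intro continuous_intros)
  have minus: "continuous_map (prod_topology euclidean euclidean) euclidean (\<lambda>(a :: 'g, b :: 'g). - a)"
    unfolding prod_topology_euclidean continuous_map_iff_continuous2 case_prod_unfold
    unfolding continuous_on_def by (intro ballI tendsto_intros)
  have ext: "restrict f (topspace X) = f" if "f \<in> continuous_functions X (euclidean :: 'g topology)" for f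
    using that by (simp add: continuous_functions_def extensional_restrict)
  have minus_closed: "restrict (\<lambda>x. - f x) (topspace X) \<in> carrier ?G" if "f \<in> carrier ?G" for f
    using continuous_functions_pointwise[OF minus, of f X f] that by (simp add: function_group_simps)
  have "group ?G"
  proof (rule groupI)
    show "f \<otimes>\<^bsub>?G\<^esub> g \<in> carrier ?G" if "f \<in> carrier ?G" "g \<in> carrier ?G" for f g
      using that continuous_functions_pointwise[OF add] by (simp add: function_group_simps)
    show "\<one>\<^bsub>?G\<^esub> \<in> carrier ?G"
      by (simp add: function_group_simps continuous_functions_def)
    show "f \<otimes>\<^bsub>?G\<^esub> g \<otimes>\<^bsub>?G\<^esub> h = f \<otimes>\<^bsub>?G\<^esub> (g \<otimes>\<^bsub>?G\<^esub> h)" for f g h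
      by (auto simp: function_group_simps add.assoc restrict_def)
    show "\<one>\<^bsub>?G\<^esub> \<otimes>\<^bsub>?G\<^esub> f = f" if "f \<in> carrier ?G" for f
      using ext[of f] that by (simp add: function_group_simps cong: restrict_cong)
    show "\<exists>g\<in>carrier ?G. g \<otimes>\<^bsub>?G\<^esub> f = \<one>\<^bsub>?G\<^esub>" if "f \<in> carrier ?G" for f
      by (rule bexI[OF _ minus_closed[OF that]]) (simp add: function_group_simps cong: restrict_cong)
  qed
  then interpret group ?G .
  have inv: "inv\<^bsub>?G\<^esub> f = restrict (\<lambda>x. - f x) (topspace X)" if "f \<in> carrier ?G" for f
    by (rule inv_equality[OF _ that minus_closed[OF that]]) (simp add: function_group_simps cong: restrict_cong)
  have "continuous_map ?T ?T
      ((\<lambda>(f, g). restrict (\<lambda>x. - f x) (topspace X)) \<circ> (\<lambda>f. (f, f)))"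
    by (intro continuous_map_compose[OF _ continuous_map_pointwise[OF assms minus]]
        continuous_map_pairedI continuous_map_id[unfolded id_def])
  then have "continuous_map ?T ?T (\<lambda>f. inv\<^bsub>?G\<^esub> f)"
    by (rule continuous_map_eq) (simp add: inv function_group_simps)
  moreover have "continuous_map (prod_topology ?T ?T) ?T (\<lambda>(f, g). f \<otimes>\<^bsub>?G\<^esub> g)"
    using continuous_map_pointwise[OF assms add] by (simp add: function_group_simps)
  ultimately show ?thesis
    by unfold_locales (simp_all add: function_group_simps)
qed

lemma metrizable_imp_Frechet_Urysohn:
  assumes "metrizable_space T"
  shows "Frechet_Urysohn_space T"
proof -
  obtain M d where M: "Metric_space M d" "T = Metric_space.mtopology M d"
    using assms unfolding metrizable_space_def by blast
  show ?thesis
    unfolding Frechet_Urysohn_space_def M(2) Metric_space.closure_of_sequentially[OF M(1)] by auto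
qed

theorem proposition6p2:
  fixes X :: "'a topology"
  assumes "Hausdorff_space X" and "aleph0_space X"
    and "aleph_space (euclidean :: 'g :: {topological_group_add, t2_space} topology)"
  shows "countable_cs_star_character
           (compact_open_topology X (euclidean :: 'g topology)) \<and>
         (metrizable_space (compact_open_topology X (euclidean :: 'g topology)) \<longleftrightarrow>
          Frechet_Urysohn_space (compact_open_topology X (euclidean :: 'g topology)))"
proof -
  let ?T = "compact_open_topology X (euclidean :: 'g topology)"
  have cs: "countable_cs_star_character ?T"
    using assms(2,3) by (rule countable_cs_star_character_compact_open)
  have "regular_space X"
    using assms(2) by (simp add: aleph0_space_def)
  \<comment> \<open>This makes the metrization corollary for topological groups available for
    \<open>?T\<close>.\<close>
  then interpret topological_group "function_group X :: ('a \<Rightarrow> 'g) monoid" ?T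
    by (rule topological_group_compact_open)
  have "Hausdorff_space ?T"
    by (rule Hausdorff_space_compact_open)
      (simp add: Hausdorff_space_def disjnt_def, metis hausdorff)
  then show ?thesis
    using cs metrizable_imp_Frechet_Urysohn Frechet_Urysohn_imp_metrizable by metis
qed

end
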